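(* Let $f : \mathbb{N} \to \mathbb{R}$. If $\frac{1}{N}\sum_{n=1}^{N} |\Delta f(n)| \to 0$ as $N \to \infty$, then the sequence of exponential sums $\left\{\sum_{n=1}^{N} e(f(n)) : N \ge 1\right\}$ is unbounded.
   Context: $\mathbb{N} = \{1,2,3,\ldots\}$. For real $x$, $e(x) := e^{2\pi i x}$. For $f : \mathbb{N} \to \mathbb{R}$, $\Delta f(n) := f(n+1) - f(n)$. *)

theory Defs
  imports "HOL-Analysis.Analysis"
begin

definition unit_exp :: "real \<Rightarrow> complex" where
  "unit_exp x = exp (2 * of_real pi * \<i> * of_real x)"

(* Functions on the positive integers are represented by functions on nat;
   the value at 0 is a junk value that is never used. *)

definition fwd_diff :: "(nat \<Rightarrow> real) \<Rightarrow> nat \<Rightarrow> real" where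
  "fwd_diff f n = f (n + 1) - f n"

end

theory Submission
  imports Defs
begin

text \<open>
  If the mean of \<open>\<bar>\<Delta>f\<bar>\<close> tends to \<open>0\<close>, then for each \<open>H\<close> some block of \<open>H\<close> consecutive
  integers carries total variation of \<open>f\<close> below \<open>1 / (4\<pi>)\<close>. All terms \<open>e(f(n))\<close> over such a block
  lie within \<open>1/2\<close> of the first one, so the block sum has modulus at least \<open>H / 2\<close>. As the block
  sum is a difference of two partial sums, these cannot stay bounded.
\<close>

lemma norm_unit_exp [simp]: "norm (unit_exp x) = 1"
proof -
  have "unit_exp x = cis (2 * pi * x)"
    by (simp add: unit_exp_def cis_conv_exp mult_ac)
  then show ?thesis by simp
qed

text \<open>A chord is no longer than its arc: factoring out the unimodular
  \<open>unit_exp y\<close> leaves \<open>2 * \<bar>sin (t / 2)\<bar>\<close> with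
  \<open>t = 2 * pi * (x - y)\<close>, which is at most \<open>\<bar>t\<bar>\<close>.\<close>

lemma norm_unit_exp_diff_le: "norm (unit_exp x - unit_exp y) \<le> 2 * pi * \<bar>x - y\<bar>"
proof -
  have "unit_exp x - unit_exp y = unit_exp y * (exp (\<i> * complex_of_real (2 * pi * (x - y))) - 1)"
    by (simp add: unit_exp_def algebra_simps flip: exp_add)
  then have "norm (unit_exp x - unit_exp y)
      = norm (exp (\<i> * complex_of_real (2 * pi * (x - y))) - 1)"
    by (simp add: norm_mult)
  also have "\<dots> = 2 * \<bar>sin (2 * pi * (x - y) / 2)\<bar>"
    by (rule dist_exp_i_1)
  also have "\<dots> \<le> 2 * \<bar>2 * pi * (x - y) / 2\<bar>"
    by (intro mult_left_mono abs_sin_x_le_abs_x) simp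
  also have "\<dots> = 2 * pi * \<bar>x - y\<bar>"
    by (simp add: abs_mult)
  finally show ?thesis .
qed

lemma sum_atLeastAtMost_block:
  fixes g :: "nat \<Rightarrow> 'a::comm_monoid_add"
  shows "sum g {1..a + b} = sum g {1..a} + sum g {a+1..a+b}"
  using sum.ub_add_nat[of 1 a g b] by simp

text \<open>Otherwise tiling \<open>{1..M * H}\<close> by \<open>M\<close> blocks of length
  \<open>H\<close> would keep the mean at or above \<open>e / H\<close> for every positive
  \<open>M\<close>, against the limit \<open>0\<close>.\<close>

lemma exists_block_sum_less:
  fixes g :: "nat \<Rightarrow> real"
  assumes lim: "(\<lambda>N. 1 / real N * sum g {1..N}) \<longlonglongrightarrow> 0"
    and "H > 0" "e > 0"
  shows "\<exists>k. sum g {k+1..k+H} < e"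
proof (rule ccontr)
  assume "\<nexists>k. sum g {k+1..k+H} < e"
  then have block: "e \<le> sum g {k+1..k+H}" for k
    by (meson not_le)
  have blocks: "real M * e \<le> sum g {1..M * H}" for M
  proof (induction M)
    case (Suc M)
    then show ?case
      using block[of "M * H"] sum_atLeastAtMost_block[of g "M * H" H]
      by (simp add: algebra_simps)
  qed simp
  have "e / H > 0"
    using assms by simp
  then have "\<forall>\<^sub>F N in sequentially. 1 / real N * sum g {1..N} < e / H"
    by (rule order_tendstoD(2)[OF lim])
  then obtain N0 where N0: "1 / real N * sum g {1..N} < e / H" if "N \<ge> N0" for N
    by (auto simp: eventually_sequentially)
  \<comment> \<open>The successor keeps \<open>M * H\<close> positive even if \<open>N0 = 0\<close>,
    so the mean can be multiplied out.\<close>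
  define M where "M = Suc N0"
  have "M * H \<ge> N0"
    using \<open>H > 0\<close> by (cases H) (auto simp: M_def)
  have "real (M * H) > 0"
    unfolding of_nat_0_less_iff using \<open>H > 0\<close> by (simp add: M_def)
  with N0[OF \<open>M * H \<ge> N0\<close>] have "sum g {1..M * H} < e / H * real (M * H)"
    by (simp only: mult_1 times_divide_eq_left pos_divide_less_eq)
  also have "\<dots> = real M * e"
    using \<open>H > 0\<close> by simp
  finally have "sum g {1..M * H} < real M * e" .
  with blocks[of M] show False by simp
qed

lemma abs_diff_le_sum_fwd_diff: "\<bar>f (k + i) - f k\<bar> \<le> (\<Sum>n=k..<k+i. \<bar>fwd_diff f n\<bar>)"
proof -
  have "f (k + i) - f k = (\<Sum>n=k..<k+i. fwd_diff f n)"
    by (simp add: fwd_diff_def sum_Suc_diff')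
  then show ?thesis by (simp add: sum_abs)
qed

lemma norm_block_sum_ge:
  assumes "(\<Sum>n=k+1..k+H. \<bar>fwd_diff f n\<bar>) \<le> 1 / (4 * pi)"
  shows "real H / 2 \<le> norm (\<Sum>n=k+1..k+H. unit_exp (f n))"
proof -
  let ?B = "{k+1..k+H}" and ?u = "unit_exp (f (k+1))"
  have close: "norm (?u - unit_exp (f n)) \<le> 1 / 2" if n: "n \<in> ?B" for n
  proof -
    obtain i where i: "n = (k + 1) + i"
      using n by (metis atLeastAtMost_iff le_Suc_ex)
    have "\<bar>f (k+1) - f n\<bar> \<le> (\<Sum>m=k+1..<n. \<bar>fwd_diff f m\<bar>)"
      using abs_diff_le_sum_fwd_diff[of f "k+1" i] by (simp add: i abs_minus_commute)
    \<comment> \<open>Since \<open>n \<le> k + H\<close>, the range stays inside the block, and the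
      added terms are nonnegative.\<close>
    also have "\<dots> \<le> (\<Sum>m=k+1..k+H. \<bar>fwd_diff f m\<bar>)"
      using n by (intro sum_mono2) auto
    also note assms
    \<comment> \<open>The threshold \<open>1 / (4 * pi)\<close> is chosen to cancel the Lipschitz
      constant \<open>2 * pi\<close> down to \<open>1 / 2\<close>.\<close>
    finally have "2 * pi * \<bar>f (k+1) - f n\<bar> \<le> 1 / 2"
      by (simp add: field_simps)
    with norm_unit_exp_diff_le[of "f (k+1)" "f n"] show ?thesis
      by linarith
  qed
  \<comment> \<open>Compare the block sum with \<open>H\<close> copies of its first term: the
    \<open>H\<close> errors cost at most \<open>1 / 2\<close> each.\<close>
  have "real H = norm (of_nat H * ?u)"
    by (simp add: norm_mult)
  also have "of_nat H * ?u = (\<Sum>n\<in>?B. unit_exp (f n)) + (\<Sum>n\<in>?B. ?u - unit_exp (f n))"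
    by (simp add: sum_subtractf)
  also have "norm \<dots> \<le> norm (\<Sum>n\<in>?B. unit_exp (f n)) + norm (\<Sum>n\<in>?B. ?u - unit_exp (f n))"
    by (rule norm_triangle_ineq)
  also have "norm (\<Sum>n\<in>?B. ?u - unit_exp (f n)) \<le> real H / 2"
    using sum_norm_bound[of ?B "\<lambda>n. ?u - unit_exp (f n)" "1/2"] close by simp
  finally show ?thesis by simp
qed

theorem theorem2p7:
  fixes f :: "nat \<Rightarrow> real"
  assumes "(\<lambda>N. 1 / real N * (\<Sum>n=1..N. \<bar>fwd_diff f n\<bar>)) \<longlonglongrightarrow> 0"
  shows "\<not> bounded {(\<Sum>n=1..N. unit_exp (f n)) | N::nat. N \<ge> 1}"
proof
  let ?S = "\<lambda>N. \<Sum>n=1..N. unit_exp (f n)"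
  assume "bounded {?S N | N::nat. N \<ge> 1}"
  then obtain C where "C > 0" and C: "\<And>N. N \<ge> 1 \<Longrightarrow> norm (?S N) \<le> C"
    unfolding bounded_pos by blast
  \<comment> \<open>The empty sum at \<open>N = 0\<close> is included because the block found below
    may start at \<open>1\<close>, that is, \<open>k = 0\<close>.\<close>
  have bound: "norm (?S N) \<le> C" for N
    using C[of N] \<open>C > 0\<close> by (cases "N = 0") auto
  \<comment> \<open>This makes \<open>H / 2\<close> exceed \<open>2 * C\<close>, the bound for a
    difference of two partial sums.\<close>
  obtain H :: nat where H: "real H > 4 * C"
    using reals_Archimedean2 by blast
  with \<open>C > 0\<close> have "H > 0"
    by (cases H) auto
  then obtain k where "(\<Sum>n=k+1..k+H. \<bar>fwd_diff f n\<bar>) < 1 / (4 * pi)"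
    using exists_block_sum_less[OF assms, of H "1 / (4 * pi)"] by auto
  then have "real H / 2 \<le> norm (\<Sum>n=k+1..k+H. unit_exp (f n))"
    by (intro norm_block_sum_ge) simp
  also have "\<dots> = norm (?S (k + H) - ?S k)"
    by (simp only: sum_atLeastAtMost_block add_diff_cancel_left')
  also have "\<dots> \<le> norm (?S (k + H)) + norm (?S k)"
    by (rule norm_triangle_ineq4)
  also have "\<dots> \<le> 2 * C"
    using bound[of "k + H"] bound[of k] by simp
  finally show False using H by simp
qed

end
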